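(* Let $n\ge 1$ be an integer and let $f:[0,1)^n\to[0,1)$ be any increasing function. Let $X_1,\ldots,X_{n+1}$ be independent and uniform on $[0,1)$, and let $|ALT_n(f)|$ denote the number of bits revealed by the alternating algorithm $ALT_n$ on the function $f$ and the input $(X_1,\ldots,X_{n+1})$. Then $$\mathbb{E}\left|ALT_n(f)\right| \le \sum_{k \ge 0}\; \sum_{i=0}^n \left( 1 - \frac{(2^{k+1}-1)^i\,(2^k-1)^{n+1-i}}{2^{k(n+1)+i}} \right).$$ In particular, $\mathcal{B}(n)=O(n^2)$, i.e. there is a constant $C>0$ such that $\mathcal{B}(n)\le C n^2$ for all integers $n\ge 1$.
   Context: Increasing functions. A function $f$ of $n$ real variables is called increasing if $f(\mathbf{x}')\le f(\mathbf{x})$ whenever every coordinate of $\mathbf{x}'$ is less than or equal to the corresponding coordinate of $\mathbf{x}$. $\mathcal{F}_n$ denotes the set of increasing functions $[0,1)^n\to[0,1)$. Bits. For $x\in[0,1)$, $x^{(i)}\in\{0,1\}$ denotes the $i$-th bit of the binary expansion $x=0.x^{(1)}x^{(2)}x^{(3)}\ldots$, where the expansion is chosen not to end in an infinite tail of 1's. Cuts and feasible sets. Let $\bar{x}_1,\ldots,\bar{x}_{n+1}$ be $n+1$ distinct symbols, called cuts. A string of cuts encodes an order of revealing bits of a point $(\mathbf{x},x_{n+1})=(x_1,\ldots,x_{n+1})\in[0,1)^{n+1}$: the $m$-th occurrence of $\bar{x}_j$ means that the bit $x_j^{(m)}$ is revealed. For a finite string of cuts $s$, let $k_j$ be the number of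 occurrences of $\bar{x}_j$ in $s$ and let $x_j^*=0.x_j^{(1)}\ldots x_j^{(k_j)}$ be the truncation of $x_j$ to its first $k_j$ bits. The feasible set after $s$ (for the input $(\mathbf{x},x_{n+1})$) is the box $S=\prod_{j=1}^{n+1}[x_j^*,x_j^*+2^{-k_j})$. Crossing. A function $f\in\mathcal{F}_n$ crosses a box $S\subseteq[0,1)^{n+1}$ if both sets $S\cap\{(\mathbf{y},y_{n+1}): f(\mathbf{y})<y_{n+1}\}$ and $S\cap\{(\mathbf{y},y_{n+1}): f(\mathbf{y})>y_{n+1}\}$ have positive Lebesgue measure. Algorithms. $\mathcal{A}_n$ is the set of all maps $A$ that assign to each $f\in\mathcal{F}_n$ and $(\mathbf{x},x_{n+1})\in[0,1)^{n+1}$ a finite or infinite string $A(f,\mathbf{x},x_{n+1})$ of cuts and satisfy: (1) (unrevealed bits have no influence) for all $f\in\mathcal{F}_n$, all integers $p_1,\ldots,p_{n+1}\ge 0$ and all points $(\mathbf{x},x_{n+1}),(\mathbf{x}',x'_{n+1})\in[0,1)^{n+1}$ with $x_j^{(i)}=x_j'^{(i)}$ for all $1\le i\le p_j$, $1\le j\le n+1$: if $s$ is a finite prefix of $A(f,\mathbf{x},x_{n+1})$ containing $\bar{x}_j$ at most $p_j$ times for each $j$, then for every $\ell\le|s|+1$ the length-$\ell$ prefixes of $A(f,\mathbf{x},x_{n+1})$ and $A(f,\mathbf{x}',x'_{n+1})$ are identical (the length-$\ell$ prefix of a string of length less than $\ell$ being the string itself); (2) (halting) if $A(f,\mathbf{x},x_{n+1})$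 is a finite string $s$, then $f$ does not cross the feasible set after $s$ for the input $(\mathbf{x},x_{n+1})$. $|\cdot|$ denotes the length of a string (possibly $\infty$). The quantity $\mathcal{B}(n)$. With $X_1,\ldots,X_{n+1}$ independent and uniform on $[0,1)$ and $A(f)=A(f,X_1,\ldots,X_{n+1})$, $$\mathcal{B}(n)=\inf_{A\in\mathcal{A}_n}\ \sup_{f\in\mathcal{F}_n}\ \mathbb{E}|A(f)|.$$ The alternating algorithm. $ALT_n(f,\mathbf{x},x_{n+1})$ is the shortest prefix $s$ (possibly empty) of the infinite periodic string $\bar{x}_1\bar{x}_2\cdots\bar{x}_{n+1}\bar{x}_1\bar{x}_2\cdots\bar{x}_{n+1}\cdots$ such that $f$ does not cross the feasible set after $s$ for the input $(\mathbf{x},x_{n+1})$; it is the whole infinite string if there is no such finite prefix. $ALT_n(f)=ALT_n(f,X_1,\ldots,X_{n+1})$. *)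

theory Defs
  imports "HOL-Probability.Probability" "HOL-Library.Stream"
begin

text \<open>
  Coordinates are indexed by \<open>1, \<dots>, n + 1\<close>.  Points of \<open>[0,1)\<^sup>m\<close> are
  functions on \<open>{1..m}\<close>, made canonical by being \<open>undefined\<close> elsewhere.
\<close>

definition cube :: "nat \<Rightarrow> (nat \<Rightarrow> real) set" where
  "cube m = {1..m} \<rightarrow>\<^sub>E {0..<1}"

definition increasing_funs :: "nat \<Rightarrow> ((nat \<Rightarrow> real) \<Rightarrow> real) set" where
  "increasing_funs n = {f \<in> cube n \<rightarrow>\<^sub>E {0..<1}.
     \<forall>x\<in>cube n. \<forall>x'\<in>cube n. (\<forall>j\<in>{1..n}. x' j \<le> x j) \<longrightarrow> f x' \<le> f x}"

definition bin_digit :: "real \<Rightarrow> nat \<Rightarrow> int" where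
  "bin_digit x i = \<lfloor>2 ^ i * x\<rfloor> mod 2"

definition truncation :: "nat \<Rightarrow> real \<Rightarrow> real" where
  "truncation k x = (\<Sum>i=1..k. real_of_int (bin_digit x i) / 2 ^ i)"

text \<open>
  The following lemmas show that \<open>bin_digit x 1, bin_digit x 2, \<dots>\<close> is the
  binary expansion of \<open>x \<in> [0,1)\<close> that does not end in an infinite tail of ones.
\<close>

lemma bin_digit_cases: "bin_digit x i = 0 \<or> bin_digit x i = 1"
  unfolding bin_digit_def by presburger

lemma floor_double_eq: "\<lfloor>2 ^ Suc k * x\<rfloor> = 2 * \<lfloor>2 ^ k * x\<rfloor> + bin_digit x (Suc k)"
proof -
  have "\<lfloor>2 ^ Suc k * x\<rfloor> div 2 = \<lfloor>2 ^ k * x\<rfloor>"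
    using floor_divide_real_eq_div[of 2 "2 ^ Suc k * x"] by simp
  then show ?thesis
    unfolding bin_digit_def by presburger
qed

lemma truncation_eq_floor:
  assumes "x \<in> {0..<1}"
  shows "truncation k x = \<lfloor>2 ^ k * x\<rfloor> / 2 ^ k"
proof (induction k)
  case 0
  have "\<lfloor>x\<rfloor> = 0" using assms by (simp add: floor_eq_iff)
  then show ?case by (simp add: truncation_def)
next
  case (Suc k)
  have "truncation (Suc k) x = truncation k x + bin_digit x (Suc k) / 2 ^ Suc k"
    by (simp add: truncation_def)
  then show ?case
    unfolding Suc.IH floor_double_eq by (simp add: field_simps)
qed

lemma truncation_tendsto:
  assumes "x \<in> {0..<1}"
  shows "(\<lambda>k. truncation k x) \<longlonglongrightarrow> x"
proof (rule tendsto_sandwich)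
  show "\<forall>\<^sub>F k in sequentially. x - (1/2) ^ k \<le> truncation k x"
  proof (rule always_eventually, rule allI)
    fix k
    have "2 ^ k * x - 1 \<le> \<lfloor>2 ^ k * x\<rfloor>" by linarith
    then have "(2 ^ k * x - 1) / 2 ^ k \<le> \<lfloor>2 ^ k * x\<rfloor> / 2 ^ k"
      by (rule divide_right_mono) simp
    then show "x - (1/2) ^ k \<le> truncation k x"
      by (simp add: truncation_eq_floor[OF assms] diff_divide_distrib power_one_over)
  qed
  show "\<forall>\<^sub>F k in sequentially. truncation k x \<le> x"
  proof (rule always_eventually, rule allI)
    fix k
    have "\<lfloor>2 ^ k * x\<rfloor> \<le> 2 ^ k * x" by linarith
    then show "truncation k x \<le> x"
      by (simp add: truncation_eq_floor[OF assms] field_simps)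
  qed
  have "(\<lambda>k. x - (1/2) ^ k) \<longlonglongrightarrow> x - 0"
    by (intro tendsto_intros LIMSEQ_power_zero) simp
  then show "(\<lambda>k. x - (1/2) ^ k) \<longlonglongrightarrow> x" by simp
qed simp

lemma bin_digit_sums:
  assumes "x \<in> {0..<1}"
  shows "(\<lambda>i. real_of_int (bin_digit x (Suc i)) / 2 ^ Suc i) sums x"
proof -
  have "(\<Sum>i<k. real_of_int (bin_digit x (Suc i)) / 2 ^ Suc i) = truncation k x" for k
    unfolding truncation_def
    by (simp add: sum.atLeast1_atMost_eq lessThan_atLeast0)
  then show ?thesis
    unfolding sums_def using truncation_tendsto[OF assms] by presburger
qed

lemma bin_digit_no_tail_of_ones:
  assumes "x \<in> {0..<1}"
  shows "\<exists>i\<ge>N. bin_digit x i = 0"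
proof (rule ccontr)
  assume "\<not> (\<exists>i\<ge>N. bin_digit x i = 0)"
  then have one: "bin_digit x i = 1" if "i \<ge> N" for i
    using bin_digit_cases that by metis
  have eq: "real_of_int \<lfloor>2 ^ (N + m) * x\<rfloor> + 1 = 2 ^ m * (real_of_int \<lfloor>2 ^ N * x\<rfloor> + 1)" for m
  proof (induction m)
    case (Suc m)
    have "\<lfloor>2 ^ (N + Suc m) * x\<rfloor> = 2 * \<lfloor>2 ^ (N + m) * x\<rfloor> + 1"
      using floor_double_eq[of "N + m" x] one[of "Suc (N + m)"] by simp
    then have "real_of_int \<lfloor>2 ^ (N + Suc m) * x\<rfloor> + 1 = 2 * (real_of_int \<lfloor>2 ^ (N + m) * x\<rfloor> + 1)"
      by simp
    also have "\<dots> = 2 ^ Suc m * (real_of_int \<lfloor>2 ^ N * x\<rfloor> + 1)"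
      unfolding Suc.IH by simp
    finally show ?case .
  qed simp
  define c where "c = (real_of_int \<lfloor>2 ^ N * x\<rfloor> + 1) / 2 ^ N"
  have c: "c = truncation (m + N) x + (1/2) ^ (m + N)" for m
  proof -
    have "c = 2 ^ m * (real_of_int \<lfloor>2 ^ N * x\<rfloor> + 1) / 2 ^ (N + m)"
      by (simp add: c_def power_add)
    also have "\<dots> = (real_of_int \<lfloor>2 ^ (N + m) * x\<rfloor> + 1) / 2 ^ (N + m)"
      by (simp only: eq)
    finally show ?thesis
      by (simp add: truncation_eq_floor[OF assms] add.commute add_divide_distrib power_one_over)
  qed
  have "(\<lambda>m. truncation (m + N) x + (1/2) ^ (m + N)) \<longlonglongrightarrow> x + 0"
  proof (intro tendsto_add)
    show "(\<lambda>m. truncation (m + N) x) \<longlonglongrightarrow> x"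
      by (rule LIMSEQ_ignore_initial_segment[OF truncation_tendsto[OF assms]])
    show "(\<lambda>m. (1/2 :: real) ^ (m + N)) \<longlonglongrightarrow> 0"
      by (rule LIMSEQ_ignore_initial_segment, rule LIMSEQ_power_zero) simp
  qed
  then have "(\<lambda>m. c) \<longlonglongrightarrow> x"
    by (simp flip: c)
  then have "c = x"
    by (simp add: LIMSEQ_const_iff)
  moreover have "2 ^ N * x < real_of_int \<lfloor>2 ^ N * x\<rfloor> + 1"
    by linarith
  ultimately show False
    by (simp add: c_def field_simps)
qed

text \<open>Finite or infinite strings; the cut belonging to coordinate \<open>j\<close> is represented by \<open>j\<close>.\<close>

datatype 'a inf_string = FinStr "'a list" | InfStr "'a stream"

fun str_length :: "'a inf_string \<Rightarrow> enat" where
  "str_length (FinStr s) = enat (length s)"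
| "str_length (InfStr w) = \<infinity>"

fun str_take :: "nat \<Rightarrow> 'a inf_string \<Rightarrow> 'a list" where
  "str_take l (FinStr s) = take l s"
| "str_take l (InfStr w) = stake l w"

definition fin_prefix :: "'a list \<Rightarrow> 'a inf_string \<Rightarrow> bool" where
  "fin_prefix s w \<longleftrightarrow> (\<exists>l. s = str_take l w)"

definition cut_strings :: "nat \<Rightarrow> nat inf_string set" where
  "cut_strings n = {w. set_inf_string w \<subseteq> {1..n+1}}"

definition feasible_set :: "nat \<Rightarrow> (nat \<Rightarrow> real) \<Rightarrow> nat list \<Rightarrow> (nat \<Rightarrow> real) set" where
  "feasible_set n x s = (\<Pi>\<^sub>E j\<in>{1..n+1}.
     {truncation (count_list s j) (x j) ..< truncation (count_list s j) (x j) + 1 / 2 ^ count_list s j})"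

text \<open>
  Lebesgue measure is the completion of the product of Borel measures.  The completion
  matters: for \<open>n \<ge> 2\<close> an increasing function need not be Borel measurable.
\<close>

definition lebesgue_measure :: "nat \<Rightarrow> (nat \<Rightarrow> real) measure" where
  "lebesgue_measure m = completion (PiM {1..m} (\<lambda>_. lborel))"

definition crosses :: "nat \<Rightarrow> ((nat \<Rightarrow> real) \<Rightarrow> real) \<Rightarrow> (nat \<Rightarrow> real) set \<Rightarrow> bool" where
  "crosses n f S \<longleftrightarrow>
     emeasure (lebesgue_measure (n+1)) (S \<inter> {y. f (restrict y {1..n}) < y (n+1)}) > 0 \<and>
     emeasure (lebesgue_measure (n+1)) (S \<inter> {y. f (restrict y {1..n}) > y (n+1)}) > 0"

type_synonym algorithm = "((nat \<Rightarrow> real) \<Rightarrow> real) \<Rightarrow> (nat \<Rightarrow> real) \<Rightarrow> nat inf_string"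

definition unrevealed_no_influence :: "nat \<Rightarrow> algorithm \<Rightarrow> bool" where
  "unrevealed_no_influence n A \<longleftrightarrow>
     (\<forall>f\<in>increasing_funs n. \<forall>p :: nat \<Rightarrow> nat. \<forall>x\<in>cube (n+1). \<forall>x'\<in>cube (n+1).
        (\<forall>j\<in>{1..n+1}. \<forall>i\<in>{1..p j}. bin_digit (x j) i = bin_digit (x' j) i) \<longrightarrow>
        (\<forall>s. fin_prefix s (A f x) \<and> (\<forall>j\<in>{1..n+1}. count_list s j \<le> p j) \<longrightarrow>
           (\<forall>l\<le>length s + 1. str_take l (A f x) = str_take l (A f x'))))"

definition halting :: "nat \<Rightarrow> algorithm \<Rightarrow> bool" where
  "halting n A \<longleftrightarrow>
     (\<forall>f\<in>increasing_funs n. \<forall>x\<in>cube (n+1). \<forall>s.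
        A f x = FinStr s \<longrightarrow> \<not> crosses n f (feasible_set n x s))"

definition algorithms :: "nat \<Rightarrow> algorithm set" where
  "algorithms n = {A \<in> increasing_funs n \<rightarrow>\<^sub>E (cube (n+1) \<rightarrow>\<^sub>E cut_strings n).
     unrevealed_no_influence n A \<and> halting n A}"

text \<open>The joint law of \<open>n + 1\<close> independent uniform variables; it is concentrated on \<open>cube (n+1)\<close>.\<close>

definition input_law :: "nat \<Rightarrow> (nat \<Rightarrow> real) measure" where
  "input_law n = PiM {1..n+1} (\<lambda>_. uniform_measure lborel {0..<1})"

definition expected_length :: "nat \<Rightarrow> algorithm \<Rightarrow> ((nat \<Rightarrow> real) \<Rightarrow> real) \<Rightarrow> ennreal" where
  "expected_length n A f = (\<integral>\<^sup>+ x. ennreal_of_enat (str_length (A f x)) \<partial>input_law n)"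

definition calB :: "nat \<Rightarrow> ennreal" where
  "calB n = (\<Sqinter>A\<in>algorithms n. \<Squnion>f\<in>increasing_funs n. expected_length n A f)"

definition ALT :: "nat \<Rightarrow> algorithm" where
  "ALT n f x =
     (let w = cycle [1..<n+2];
          stops = (\<lambda>l. \<not> crosses n f (feasible_set n x (stake l w)))
      in if \<exists>l. stops l then FinStr (stake (LEAST l. stops l) w) else InfStr w)"

end

theory Submission imports Defs begin

text \<open>
  After the first \<open>l\<close> cuts of the alternating string, the possible feasible sets are the cells of
  a dyadic grid.  By monotonicity \<open>f\<close> cannot cross two cells one of which is strictly larger in the
  coordinates \<open>1, \<dots>, n\<close> and strictly smaller in coordinate \<open>n + 1\<close>.  Hence each diagonal line of
  cells in the direction \<open>(1, \<dots>, 1, -1)\<close> contains at most one crossed cell.  A grid with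
  side lengths \<open>m\<^sub>j\<close> has \<open>\<Prod>m\<^sub>j - \<Prod>(m\<^sub>j - 1)\<close> such lines, which bounds the
  probability that the algorithm reveals more than \<open>l\<close> bits; the sum over \<open>l\<close> bounds the expectation.
  Bernoulli's inequality bounds every term of the series by \<open>(n + 1) / 2\<^sup>k\<close>, so its sum is at most
  \<open>2 (n + 1)\<^sup>2 \<le> 8 n\<^sup>2\<close>.
\<close>

section \<open>Weak antichains in a grid\<close>

text \<open>Every line in direction (1, ..., 1) starts at exactly one grid point with a zero
  coordinate, and \<open>C\<close> meets each line at most once. So \<open>C\<close> injects into
  the grid minus the box of points with all coordinates positive, whose size is the product of the
  \<open>m i - 1\<close>.\<close>

lemma card_weak_antichain_le:
  fixes m :: "'a \<Rightarrow> nat"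
  assumes I: "finite I" "I \<noteq> {}"
    and C: "C \<subseteq> (\<Pi>\<^sub>E i\<in>I. {..<m i})"
    and anti: "\<And>c d. c \<in> C \<Longrightarrow> d \<in> C \<Longrightarrow> \<not> (\<forall>i\<in>I. c i < d i)"
  shows "card C \<le> (\<Prod>i\<in>I. m i) - (\<Prod>i\<in>I. m i - 1)"
proof -
  \<comment> \<open>Move every point back along its diagonal until it meets the boundary of the grid.\<close>
  define \<rho> where "\<rho> c = restrict (\<lambda>i. c i - Min (c ` I)) I" for c :: "'a \<Rightarrow> nat"
  have Min_le: "Min (c ` I) \<le> c i" if "i \<in> I" for c :: "'a \<Rightarrow> nat" and i
    using that I by simp
  \<comment> \<open>Points with equal image differ by a constant shift. By symmetry \<open>c\<close>
    may be taken as the lower one; a positive shift would place it strictly below \<open>d\<close>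
    in every coordinate.\<close>
  have eq: "c = d" if c: "c \<in> C" and d: "d \<in> C" and \<rho>: "\<rho> c = \<rho> d"
    and le: "Min (c ` I) \<le> Min (d ` I)" for c d
  proof -
    have shift: "d i = c i + (Min (d ` I) - Min (c ` I))" if i: "i \<in> I" for i
      using fun_cong[OF \<rho>, of i] Min_le[OF i, of c] Min_le[OF i, of d] i le by (simp add: \<rho>_def)
    have "Min (d ` I) - Min (c ` I) = 0"
    proof (rule ccontr)
      assume "Min (d ` I) - Min (c ` I) \<noteq> 0"
      then have "c i < d i" if "i \<in> I" for i
        using shift[OF that] by linarith
      then show False
        using anti[OF c d] by blast
    qed
    then have "c i = d i" if "i \<in> I" for i
      using shift[OF that] by simp
    with c d C show ?thesis
      by (intro PiE_ext[of c I _ d]) auto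
  qed
  have inj: "inj_on \<rho> C"
    by (rule inj_onI) (metis eq nat_le_linear)
  let ?A = "(\<Pi>\<^sub>E i\<in>I. {..<m i})" and ?B = "(\<Pi>\<^sub>E i\<in>I. {1..<m i})"
  have "\<rho> ` C \<subseteq> ?A - ?B"
  proof
    fix d assume "d \<in> \<rho> ` C"
    then obtain c where c: "c \<in> C" and d: "d = \<rho> c" by blast
    have "c i < m i" if "i \<in> I" for i
      using c C that by blast
    then have "d \<in> ?A"
      unfolding d \<rho>_def by (auto intro: less_imp_diff_less)
    obtain i where i: "i \<in> I" "c i = Min (c ` I)"
      using Min_in[of "c ` I"] I by (metis (no_types, lifting) empty_is_image finite_imageI imageE)
    then have "d i = 0"
      unfolding d \<rho>_def by simp
    with i \<open>d \<in> ?A\<close> show "d \<in> ?A - ?B"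
      by (force simp: PiE_iff)
  qed
  then have "card C \<le> card (?A - ?B)"
    using I by (intro card_inj_on_le[OF inj]) (auto intro: finite_PiE)
  also have "\<dots> = card ?A - card ?B"
    using I by (intro card_Diff_subset) (auto intro: finite_PiE simp: PiE_iff)
  also have "\<dots> = (\<Prod>i\<in>I. m i) - (\<Prod>i\<in>I. m i - 1)"
    using I by (simp add: card_PiE)
  finally show ?thesis .
qed

text \<open>Reflecting the coordinates in \<open>J\<close> by \<open>m i - 1 - c i\<close> maps the
  grid to itself and reverses the order there, which reduces mixed directions to the direction (1,
  ..., 1).\<close>

lemma card_weak_antichain_flip_le:
  fixes m :: "'a \<Rightarrow> nat"
  assumes I: "finite I" "I \<noteq> {}"
    and C: "C \<subseteq> (\<Pi>\<^sub>E i\<in>I. {..<m i})"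
    and anti: "\<And>c d. c \<in> C \<Longrightarrow> d \<in> C \<Longrightarrow>
      \<not> ((\<forall>i\<in>I - J. c i < d i) \<and> (\<forall>i\<in>I \<inter> J. d i < c i))"
  shows "card C \<le> (\<Prod>i\<in>I. m i) - (\<Prod>i\<in>I. m i - 1)"
proof -
  define \<phi> where "\<phi> c = restrict (\<lambda>i. if i \<in> J then m i - 1 - c i else c i) I" for c
  have lt: "c i < m i" if "c \<in> C" "i \<in> I" for c i
    using C that by blast
  have inj: "inj_on \<phi> C"
  proof (rule inj_onI)
    fix c d assume c: "c \<in> C" and d: "d \<in> C" and \<phi>: "\<phi> c = \<phi> d"
    have "c i = d i" if i: "i \<in> I" for i
      using fun_cong[OF \<phi>, of i] i lt[OF c i] lt[OF d i]
      by (simp add: \<phi>_def split: if_splits)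
    with c d C show "c = d"
      by (intro PiE_ext[of c I _ d]) auto
  qed
  have "card (\<phi> ` C) \<le> (\<Prod>i\<in>I. m i) - (\<Prod>i\<in>I. m i - 1)"
  proof (rule card_weak_antichain_le[OF I])
    show "\<phi> ` C \<subseteq> (\<Pi>\<^sub>E i\<in>I. {..<m i})"
      using lt by (fastforce simp: \<phi>_def)
  next
    fix c' d' assume "c' \<in> \<phi> ` C" "d' \<in> \<phi> ` C"
    then obtain c d where c: "c \<in> C" "c' = \<phi> c" and d: "d \<in> C" "d' = \<phi> d" by blast
    show "\<not> (\<forall>i\<in>I. c' i < d' i)"
    proof
      assume less: "\<forall>i\<in>I. c' i < d' i"
      have "c i < d i" if "i \<in> I - J" for i
        using bspec[OF less, of i] that by (simp add: c d \<phi>_def)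
      moreover have "d i < c i" if "i \<in> I \<inter> J" for i
        using bspec[OF less, of i] that by (simp add: c d \<phi>_def)
      ultimately show False
        using anti[OF c(1) d(1)] by blast
    qed
  qed
  then show ?thesis
    by (simp add: card_image[OF inj])
qed

section \<open>Dyadic cells\<close>

text \<open>Here \<open>p j\<close> is the number of revealed bits of coordinate \<open>j\<close>,
  and \<open>c j\<close> is the integer whose binary digits are these bits. Integer indices turn the
  geometry into counting in a finite grid.\<close>

definition dyadic_cell :: "nat \<Rightarrow> (nat \<Rightarrow> nat) \<Rightarrow> (nat \<Rightarrow> nat) \<Rightarrow> (nat \<Rightarrow> real) set" where
  "dyadic_cell n p c = (\<Pi>\<^sub>E j\<in>{1..n+1}. {real (c j) / 2 ^ p j ..< real (c j) / 2 ^ p j + 1 / 2 ^ p j})"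

definition dyadic_indices :: "nat \<Rightarrow> (nat \<Rightarrow> nat) \<Rightarrow> (nat \<Rightarrow> nat) set" where
  "dyadic_indices n p = (\<Pi>\<^sub>E j\<in>{1..n+1}. {..<2 ^ p j})"

definition crossed_indices :: "nat \<Rightarrow> ((nat \<Rightarrow> real) \<Rightarrow> real) \<Rightarrow> (nat \<Rightarrow> nat) \<Rightarrow> (nat \<Rightarrow> nat) set" where
  "crossed_indices n f p = {c \<in> dyadic_indices n p. crosses n f (dyadic_cell n p c)}"

lemma finite_crossed_indices: "finite (crossed_indices n f p)"
  by (auto simp: crossed_indices_def dyadic_indices_def intro!: finite_subset[OF Collect_restrict] finite_PiE)

lemma dyadic_interval_subset:
  assumes "c < (2::nat) ^ p"
  shows "{real c / 2 ^ p ..< real c / 2 ^ p + 1 / 2 ^ p} \<subseteq> {0..<1}"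
proof -
  have "real c + 1 \<le> 2 ^ p"
    using assms by (metis Suc_leI of_nat_Suc of_nat_le_iff of_nat_numeral of_nat_power add.commute)
  then have "real c / 2 ^ p + 1 / 2 ^ p \<le> 1"
    by (simp add: field_simps)
  then show ?thesis by (auto intro: order_trans[rotated])
qed

lemma dyadic_cell_subset_cube:
  assumes "c \<in> dyadic_indices n p"
  shows "dyadic_cell n p c \<subseteq> cube (n+1)"
  unfolding dyadic_cell_def cube_def
  by (rule PiE_mono, rule dyadic_interval_subset) (use assms in \<open>auto simp: dyadic_indices_def\<close>)

text \<open>Truncating to \<open>k\<close> bits gives the floor of \<open>2 ^ k * x\<close> divided
  by \<open>2 ^ k\<close>, so these floors are the index of the cell.\<close>

lemma feasible_set_eq_dyadic_cell:
  assumes x: "x \<in> cube (n+1)"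
  obtains c where "c \<in> dyadic_indices n (count_list s)"
    and "feasible_set n x s = dyadic_cell n (count_list s) c"
    and "x \<in> dyadic_cell n (count_list s) c"
proof -
  let ?p = "count_list s"
  define c where "c = restrict (\<lambda>j. nat \<lfloor>2 ^ ?p j * x j\<rfloor>) {1..n+1}"
  have xj: "x j \<in> {0..<1}" if "j \<in> {1..n+1}" for j
    using x that unfolding cube_def by blast
  have c: "real (c j) = \<lfloor>2 ^ ?p j * x j\<rfloor>" if "j \<in> {1..n+1}" for j
    using xj[OF that] that by (simp add: c_def)
  have lt: "c j < 2 ^ ?p j" if j: "j \<in> {1..n+1}" for j
  proof -
    have "real (c j) \<le> 2 ^ ?p j * x j"
      unfolding c[OF j] by linarith
    also have "\<dots> < 2 ^ ?p j * 1"
      using xj[OF j] by (intro mult_strict_left_mono) auto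
    finally have "real (c j) < real (2 ^ ?p j)" by simp
    then show ?thesis by (simp only: of_nat_less_iff)
  qed
  show thesis
  proof
    show "c \<in> dyadic_indices n ?p"
      using lt by (auto simp: dyadic_indices_def c_def)
    show "feasible_set n x s = dyadic_cell n ?p c"
      unfolding feasible_set_def dyadic_cell_def
      by (rule PiE_cong) (simp only: truncation_eq_floor[OF xj] c)
    have "x j \<in> {real (c j) / 2 ^ ?p j ..< real (c j) / 2 ^ ?p j + 1 / 2 ^ ?p j}"
      if j: "j \<in> {1..n+1}" for j
    proof -
      have "real (c j) \<le> 2 ^ ?p j * x j" "2 ^ ?p j * x j < real (c j) + 1"
        unfolding c[OF j] by linarith+
      then show ?thesis by (simp add: field_simps)
    qed
    moreover have "x \<in> extensional {1..n+1}"
      using x unfolding cube_def by (auto simp: PiE_iff)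
    ultimately show "x \<in> dyadic_cell n ?p c"
      unfolding dyadic_cell_def by (auto simp: PiE_iff)
  qed
qed

text \<open>A set of positive measure is nonempty. One point on each side of the graph is all that
  the counting argument takes from crossing.\<close>

lemma crosses_points:
  assumes "crosses n f S"
  obtains y z where "y \<in> S" "f (restrict y {1..n}) < y (n+1)"
    and "z \<in> S" "f (restrict z {1..n}) > z (n+1)"
proof -
  have "S \<inter> {y. f (restrict y {1..n}) < y (n+1)} \<noteq> {}"
    "S \<inter> {y. f (restrict y {1..n}) > y (n+1)} \<noteq> {}"
    using assms unfolding crosses_def by force+
  then show thesis using that by blast
qed

lemma dyadic_interval_less:
  fixes c d :: nat and x y :: real
  assumes "c < d"
    and "x \<in> {real c / 2 ^ p ..< real c / 2 ^ p + 1 / 2 ^ p}"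
    and "y \<in> {real d / 2 ^ p ..< real d / 2 ^ p + 1 / 2 ^ p}"
  shows "x < y"
proof -
  have "x < (real c + 1) / 2 ^ p"
    using assms(2) by (simp add: add_divide_distrib)
  also have "\<dots> \<le> real d / 2 ^ p"
    using assms(1) by (intro divide_right_mono) auto
  also have "\<dots> \<le> y"
    using assms(3) by simp
  finally show ?thesis .
qed

text \<open>Take \<open>y\<close> in cell \<open>c\<close> below the graph and \<open>z\<close> in
  cell \<open>d\<close> above it. If the cells were so ordered, monotonicity would give
  \<open>y (n+1) < f y <= f z < z (n+1)\<close> (arguments of \<open>f\<close> restricted), whereas
  the last coordinates are ordered the other way.\<close>

lemma crossed_indices_antichain:
  assumes f: "f \<in> increasing_funs n"
    and c: "c \<in> crossed_indices n f p" and d: "d \<in> crossed_indices n f p"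
  shows "\<not> ((\<forall>j\<in>{1..n+1} - {n+1}. c j < d j) \<and> (\<forall>j\<in>{1..n+1} \<inter> {n+1}. d j < c j))"
proof
  assume less: "(\<forall>j\<in>{1..n+1} - {n+1}. c j < d j) \<and> (\<forall>j\<in>{1..n+1} \<inter> {n+1}. d j < c j)"
  obtain y where y: "y \<in> dyadic_cell n p c" "f (restrict y {1..n}) > y (n+1)"
    using c crosses_points unfolding crossed_indices_def by blast
  obtain z where z: "z \<in> dyadic_cell n p d" "f (restrict z {1..n}) < z (n+1)"
    using d crosses_points unfolding crossed_indices_def by blast
  have in_cube: "restrict u {1..n} \<in> cube n" if "u \<in> cube (n+1)" for u
    using that unfolding cube_def by (auto simp: PiE_iff)
  have "y \<in> cube (n+1)" "z \<in> cube (n+1)"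
    using y z c d dyadic_cell_subset_cube unfolding crossed_indices_def by blast+
  moreover have "y j < z j" if j: "j \<in> {1..n}" for j
  proof (rule dyadic_interval_less)
    show "c j < d j" using less j by simp
  qed (use y z j in \<open>auto simp: dyadic_cell_def PiE_iff\<close>)
  ultimately have "f (restrict y {1..n}) \<le> f (restrict z {1..n})"
    using f in_cube unfolding increasing_funs_def by (simp add: less_imp_le)
  moreover have "z (n+1) < y (n+1)"
  proof (rule dyadic_interval_less)
    show "d (n+1) < c (n+1)" using less by simp
  qed (use y z in \<open>auto simp: dyadic_cell_def PiE_iff\<close>)
  ultimately show False using y z by linarith
qed

lemma card_crossed_indices_le:
  assumes "f \<in> increasing_funs n"
  shows "card (crossed_indices n f p) \<le> (\<Prod>j\<in>{1..n+1}. 2 ^ p j) - (\<Prod>j\<in>{1..n+1}. 2 ^ p j - 1)"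
proof (rule card_weak_antichain_flip_le[where J = "{n+1}"])
  show "crossed_indices n f p \<subseteq> (\<Pi>\<^sub>E j\<in>{1..n+1}. {..<2 ^ p j})"
    unfolding crossed_indices_def dyadic_indices_def by blast
qed (use crossed_indices_antichain[OF assms] in auto)

section \<open>The law of the input\<close>

lemma prob_space_uniform_unit: "prob_space (uniform_measure lborel {0..<1::real})"
  by (rule prob_space_uniform_measure) auto

lemma prob_space_input_law: "prob_space (input_law n)"
  unfolding input_law_def by (intro prob_space_PiM prob_space_uniform_unit)

lemma sets_input_law_box:
  "(\<Pi>\<^sub>E j\<in>{1..n+1}. {a j..<b j}) \<in> sets (input_law n)"
  unfolding input_law_def by (rule sets_PiM_I_finite) auto

lemma emeasure_input_law_box:
  assumes "\<And>j. j \<in> {1..n+1} \<Longrightarrow> {a j..<b j} \<subseteq> {0..<1::real}"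
    and "\<And>j. j \<in> {1..n+1} \<Longrightarrow> a j \<le> b j"
  shows "emeasure (input_law n) (\<Pi>\<^sub>E j\<in>{1..n+1}. {a j..<b j}) = ennreal (\<Prod>j\<in>{1..n+1}. b j - a j)"
proof -
  have "emeasure (input_law n) (\<Pi>\<^sub>E j\<in>{1..n+1}. {a j..<b j}) =
      (\<Prod>j\<in>{1..n+1}. emeasure (uniform_measure lborel {0..<1}) {a j..<b j})"
    unfolding input_law_def
    by (intro product_sigma_finite.emeasure_PiM product_sigma_finite.intro
        prob_space_imp_sigma_finite prob_space_uniform_unit) auto
  also have "\<dots> = (\<Prod>j\<in>{1..n+1}. ennreal (b j - a j))"
  proof (rule prod.cong[OF refl])
    fix j assume j: "j \<in> {1..n+1}"
    then have "{0..<1} \<inter> {a j..<b j} = {a j..<b j}"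
      using assms(1) by blast
    then show "emeasure (uniform_measure lborel {0..<1}) {a j..<b j} = ennreal (b j - a j)"
      using assms(2)[OF j] by (simp add: divide_ennreal_def)
  qed
  also have "\<dots> = ennreal (\<Prod>j\<in>{1..n+1}. b j - a j)"
    using assms(2) by (intro prod_ennreal) auto
  finally show ?thesis .
qed

text \<open>Lets statements about bits and feasible sets, which are available only for points of the
  cube, be used under the integral.\<close>

lemma AE_input_law_cube: "AE x in input_law n. x \<in> cube (n+1)"
proof -
  have "emeasure (input_law n) (cube (n+1)) = 1"
    unfolding cube_def by (subst emeasure_input_law_box) auto
  then show ?thesis
    by (intro prob_space.AE_prob_1[OF prob_space_input_law]) (simp add: measure_def)
qed

lemma sets_dyadic_cell: "dyadic_cell n p c \<in> sets (input_law n)"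
  unfolding dyadic_cell_def by (rule sets_input_law_box)

lemma emeasure_dyadic_cell:
  assumes "c \<in> dyadic_indices n p"
  shows "emeasure (input_law n) (dyadic_cell n p c) = ennreal (1 / (\<Prod>j\<in>{1..n+1}. 2 ^ p j))"
proof -
  have "c j < 2 ^ p j" if "j \<in> {1..n+1}" for j
    using assms that unfolding dyadic_indices_def by blast
  then have "emeasure (input_law n) (dyadic_cell n p c) =
      ennreal (\<Prod>j\<in>{1..n+1}. real (c j) / 2 ^ p j + 1 / 2 ^ p j - real (c j) / 2 ^ p j)"
    unfolding dyadic_cell_def
    by (intro emeasure_input_law_box dyadic_interval_subset) auto
  then show ?thesis
    by (simp only: add_diff_cancel_left' prod_dividef prod.neutral_const)
qed

text \<open>Covers the inputs in the cube for which \<open>f\<close> still crosses the feasible set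
  after \<open>s\<close>. As a finite union of boxes it is visibly measurable.\<close>

definition crossed_region :: "nat \<Rightarrow> ((nat \<Rightarrow> real) \<Rightarrow> real) \<Rightarrow> nat list \<Rightarrow> (nat \<Rightarrow> real) set" where
  "crossed_region n f s = (\<Union>c\<in>crossed_indices n f (count_list s). dyadic_cell n (count_list s) c)"

lemma sets_crossed_region: "crossed_region n f s \<in> sets (input_law n)"
  unfolding crossed_region_def using sets_dyadic_cell finite_crossed_indices
  by (intro sets.finite_UN) auto

lemma crosses_feasible_set_imp_crossed_region:
  assumes "x \<in> cube (n+1)" "crosses n f (feasible_set n x s)"
  shows "x \<in> crossed_region n f s"
proof -
  obtain c where "c \<in> dyadic_indices n (count_list s)"
    "feasible_set n x s = dyadic_cell n (count_list s) c"
    "x \<in> dyadic_cell n (count_list s) c"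
    using feasible_set_eq_dyadic_cell[OF assms(1)] .
  with assms(2) show ?thesis
    unfolding crossed_region_def crossed_indices_def by auto
qed

text \<open>Union bound: there are at most \<open>P - Q\<close> crossed cells, each of measure
  \<open>1 / P\<close>.\<close>

lemma emeasure_crossed_region_le:
  fixes s n
  defines "p \<equiv> count_list s"
  assumes f: "f \<in> increasing_funs n"
  shows "emeasure (input_law n) (crossed_region n f s)
    \<le> ennreal (1 - (\<Prod>j\<in>{1..n+1}. 2 ^ p j - 1) / (\<Prod>j\<in>{1..n+1}. 2 ^ p j))"
proof -
  let ?D = "crossed_indices n f p"
  define P where "P = (\<Prod>j\<in>{1..n+1}. (2::nat) ^ p j)"
  define Q where "Q = (\<Prod>j\<in>{1..n+1}. (2::nat) ^ p j - 1)"
  have P: "(\<Prod>j\<in>{1..n+1}. 2 ^ p j) = real P" and Q: "(\<Prod>j\<in>{1..n+1}. 2 ^ p j - 1) = real Q"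
    by (simp_all add: P_def Q_def of_nat_diff)
  have pos: "real P > 0"
    by (simp add: P_def prod_pos)
  \<comment> \<open>Ensures that the truncated subtraction in the cardinality bound agrees with
    subtraction of reals.\<close>
  have "Q \<le> P"
    unfolding P_def Q_def by (intro prod_mono) auto
  then have card: "real (card ?D) \<le> real P - real Q"
    using card_crossed_indices_le[OF f, of p] unfolding P_def[symmetric] Q_def[symmetric] by linarith
  have "emeasure (input_law n) (crossed_region n f s) \<le> (\<Sum>c\<in>?D. emeasure (input_law n) (dyadic_cell n p c))"
    unfolding crossed_region_def p_def
    by (intro emeasure_subadditive_finite finite_crossed_indices) (use sets_dyadic_cell in blast)
  also have "\<dots> = (\<Sum>c\<in>?D. ennreal (1 / real P))"
  proof (rule sum.cong[OF refl])
    fix c assume "c \<in> ?D"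
    then have "c \<in> dyadic_indices n p"
      unfolding crossed_indices_def by blast
    then show "emeasure (input_law n) (dyadic_cell n p c) = ennreal (1 / real P)"
      by (simp only: emeasure_dyadic_cell P)
  qed
  also have "\<dots> = ennreal (\<Sum>c\<in>?D. 1 / real P)"
    using pos by (intro sum_ennreal) simp
  also have "\<dots> = ennreal (real (card ?D) / real P)"
    by simp
  also have "\<dots> \<le> ennreal ((real P - real Q) / real P)"
    using card pos by (intro ennreal_leI divide_right_mono) auto
  also have "(real P - real Q) / real P = 1 - real Q / real P"
    using pos by (simp add: diff_divide_distrib)
  finally show ?thesis unfolding P Q .
qed

section \<open>The alternating algorithm\<close>

lemma count_list_upt: "count_list [a..<b] j = (if a \<le> j \<and> j < b then 1 else 0)"
  by (induction b) auto

text \<open>A prefix consists of \<open>k\<close> full rounds and \<open>i\<close> further cuts, and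
  these give one extra bit to the first \<open>i\<close> coordinates. The pair \<open>(k, i)\<close>
  indexes the double series.\<close>

lemma count_list_stake_alternating:
  assumes "i \<le> n" "j \<in> {1..n+1}"
  shows "count_list (stake (k * (n+1) + i) (cycle [1..<n+2])) j = (if j \<le> i then k + 1 else k)"
proof -
  have len: "length [1..<n+2] = n + 1" and ne: "[1..<n+2] \<noteq> []" by simp_all
  have "(k * (n+1) + i) div (n+1) = k" "(k * (n+1) + i) mod (n+1) = i"
    using assms(1) by (simp_all only: div_mult_self3 mod_mult_self3) auto
  then have "stake (k * (n+1) + i) (cycle [1..<n+2]) = concat (replicate k [1..<n+2]) @ [1..<i+1]"
    using assms(1) by (subst stake_cycle[OF ne]) (simp only: len take_upt; simp)
  moreover have "count_list (concat (replicate k [1..<n+2])) j = k"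
    using assms(2) by (induction k) (auto simp: count_list_upt simp del: upt_Suc)
  moreover have "count_list [1..<i+1] j = (if j \<le> i then 1 else 0)"
    using assms(2) by (auto simp: count_list_upt simp del: upt_Suc)
  ultimately show ?thesis by (simp del: upt_Suc)
qed

lemma prod_alternating:
  fixes a b :: "'a :: comm_monoid_mult"
  assumes "i \<le> n"
  shows "(\<Prod>j\<in>{1..n+1}. if j \<le> i then a else b) = a ^ i * b ^ (n + 1 - i)"
proof -
  have "{1..n+1} \<inter> {j. j \<le> i} = {1..i}" "{1..n+1} \<inter> - {j. j \<le> i} = {i+1..n+1}"
    using assms by auto
  then have "card ({1..n+1} \<inter> {j. j \<le> i}) = i" "card ({1..n+1} \<inter> - {j. j \<le> i}) = n + 1 - i"
    by (simp_all only: card_atLeastAtMost)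
  then show ?thesis
    by (simp only: prod.If_cases finite_atLeastAtMost prod_constant)
qed

lemma power_alternating:
  fixes a :: "'a :: monoid_mult"
  assumes "i \<le> n"
  shows "(a ^ (k+1)) ^ i * (a ^ k) ^ (n + 1 - i) = a ^ (k * (n + 1) + i)"
proof -
  obtain d where n: "n + 1 = i + d"
    using assms le_Suc_ex[of i "n + 1"] by auto
  have "(a ^ (k+1)) ^ i * (a ^ k) ^ d = a ^ ((k+1) * i + k * d)"
    by (simp only: power_mult power_add)
  also have "(k+1) * i + k * d = k * (i + d) + i"
    by (simp add: algebra_simps)
  finally show ?thesis
    unfolding n by simp
qed

lemma emeasure_crossed_region_alternating_le:
  assumes f: "f \<in> increasing_funs n" and i: "i \<le> n"
  shows "emeasure (input_law n) (crossed_region n f (stake (k * (n+1) + i) (cycle [1..<n+2])))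
    \<le> ennreal (1 - ((2 ^ (k+1) - 1) ^ i * (2 ^ k - 1) ^ (n + 1 - i)) / 2 ^ (k * (n + 1) + i))"
proof -
  let ?p = "count_list (stake (k * (n+1) + i) (cycle [1..<n+2]))"
  have "(\<Prod>j\<in>{1..n+1}. (2::real) ^ ?p j - 1) = (\<Prod>j\<in>{1..n+1}. if j \<le> i then 2 ^ (k+1) - 1 else 2 ^ k - 1)"
    by (intro prod.cong refl) (simp only: count_list_stake_alternating[OF i] split: if_split; simp)
  also have "\<dots> = (2 ^ (k+1) - 1) ^ i * (2 ^ k - 1) ^ (n + 1 - i)"
    by (rule prod_alternating[OF i])
  finally have Q: "(\<Prod>j\<in>{1..n+1}. (2::real) ^ ?p j - 1) = (2 ^ (k+1) - 1) ^ i * (2 ^ k - 1) ^ (n + 1 - i)" .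
  have "(\<Prod>j\<in>{1..n+1}. (2::real) ^ ?p j) = (\<Prod>j\<in>{1..n+1}. if j \<le> i then 2 ^ (k+1) else 2 ^ k)"
    by (intro prod.cong refl) (simp only: count_list_stake_alternating[OF i] split: if_split; simp)
  also have "\<dots> = (2 ^ (k+1)) ^ i * (2 ^ k) ^ (n + 1 - i)"
    by (rule prod_alternating[OF i])
  also have "\<dots> = 2 ^ (k * (n + 1) + i)"
    by (rule power_alternating[OF i])
  finally have P: "(\<Prod>j\<in>{1..n+1}. (2::real) ^ ?p j) = 2 ^ (k * (n + 1) + i)" .
  show ?thesis
    using emeasure_crossed_region_le[OF f, of "stake (k * (n+1) + i) (cycle [1..<n+2])"]
    unfolding P Q .
qed

section \<open>From crossing probabilities to the expected length\<close>

lemma crosses_before_ALT_stops: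
  assumes "enat l < str_length (ALT n f x)"
  shows "crosses n f (feasible_set n x (stake l (cycle [1..<n+2])))"
proof (cases "\<exists>l. \<not> crosses n f (feasible_set n x (stake l (cycle [1..<n+2])))")
  case True
  then have "l < (LEAST l. \<not> crosses n f (feasible_set n x (stake l (cycle [1..<n+2]))))"
    using assms by (simp add: ALT_def Let_def del: upt_Suc)
  then show ?thesis using not_less_Least by blast
qed blast

text \<open>Tail-sum principle: \<open>L\<close> is the number of \<open>l\<close> below
  \<open>L\<close>, and each contributes at least 1. An infinite \<open>L\<close> is reached as the
  supremum of its finite lower bounds.\<close>

lemma ennreal_of_enat_le_suminf:
  fixes g :: "nat \<Rightarrow> ennreal"
  assumes "\<And>l. enat l < L \<Longrightarrow> 1 \<le> g l"
  shows "ennreal_of_enat L \<le> (\<Sum>l. g l)"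
proof -
  have le: "of_nat N \<le> (\<Sum>l. g l)" if "enat N \<le> L" for N
  proof -
    have "1 \<le> g l" if "l < N" for l
      using assms \<open>enat N \<le> L\<close> that by (metis enat_ord_simps(2) less_le_trans)
    then have "(\<Sum>l<N. 1) \<le> (\<Sum>l<N. g l)"
      by (intro sum_mono) auto
    also have "\<dots> \<le> (\<Sum>l. g l)"
      by (rule sum_le_suminf) auto
    finally show ?thesis by simp
  qed
  show ?thesis
  proof (cases L)
    case (enat N)
    then show ?thesis using le by simp
  next
    case infinity
    then have "(SUP N. of_nat N) \<le> (\<Sum>l. g l)"
      using le by (intro SUP_least) simp
    then show ?thesis
      by (simp add: ennreal_SUP_of_nat_eq_top top_unique)
  qed
qed

lemma suminf_group_ennreal:
  fixes g :: "nat \<Rightarrow> ennreal"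
  shows "(\<Sum>l. g l) = (\<Sum>k. \<Sum>i=0..n. g (k * (n+1) + i))"
proof -
  have "(\<lambda>k. sum g {k * (n+1) ..< k * (n+1) + (n+1)}) sums (\<Sum>l. g l)"
    by (intro sums_group summable_sums) auto
  moreover have "sum g {k * (n+1) ..< k * (n+1) + (n+1)} = (\<Sum>i=0..n. g (k * (n+1) + i))" for k
    using sum.shift_bounds_nat_ivl[of g 0 "k * (n+1)" "n+1"]
    by (simp add: atLeast0AtMost lessThan_Suc_atMost atLeast0LessThan add.commute)
  ultimately show ?thesis by (simp add: sums_iff)
qed

theorem expected_length_ALT_le:
  assumes f: "f \<in> increasing_funs n"
  shows "expected_length n (ALT n) f
    \<le> (\<Sum>k. \<Sum>i=0..n. ennreal (1 - ((2 ^ (k+1) - 1) ^ i * (2 ^ k - 1) ^ (n + 1 - i))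
                                      / 2 ^ (k * (n + 1) + i)))"
proof -
  define R where "R l = crossed_region n f (stake l (cycle [1..<n+2]))" for l
  have R: "R l \<in> sets (input_law n)" for l
    unfolding R_def by (rule sets_crossed_region)
  \<comment> \<open>On the cube, whenever more than \<open>l\<close> bits are revealed the prefix of
    length \<open>l\<close> is still crossed, so the input lies in \<open>R l\<close>.\<close>
  have "expected_length n (ALT n) f \<le> (\<integral>\<^sup>+ x. (\<Sum>l. indicator (R l) x) \<partial>input_law n)"
    unfolding expected_length_def
  proof (rule nn_integral_mono_AE, rule AE_mp[OF AE_input_law_cube], rule AE_I2, rule impI)
    fix x assume x: "x \<in> cube (n+1)"
    show "ennreal_of_enat (str_length (ALT n f x)) \<le> (\<Sum>l. indicator (R l) x)"
    proof (rule ennreal_of_enat_le_suminf)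
      fix l assume "enat l < str_length (ALT n f x)"
      then have "x \<in> R l"
        unfolding R_def by (intro crosses_feasible_set_imp_crossed_region x crosses_before_ALT_stops)
      then show "1 \<le> (indicator (R l) x :: ennreal)" by simp
    qed
  qed
  also have "\<dots> = (\<Sum>l. emeasure (input_law n) (R l))"
    using R by (subst nn_integral_suminf) auto
  also have "\<dots> = (\<Sum>k. \<Sum>i=0..n. emeasure (input_law n) (R (k * (n+1) + i)))"
    by (rule suminf_group_ennreal)
  also have "\<dots> \<le> (\<Sum>k. \<Sum>i=0..n. ennreal (1 - ((2 ^ (k+1) - 1) ^ i * (2 ^ k - 1) ^ (n + 1 - i))
                                      / 2 ^ (k * (n + 1) + i)))"
    unfolding R_def
    by (intro suminf_le sum_mono emeasure_crossed_region_alternating_le[OF f]) auto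
  finally show ?thesis .
qed

section \<open>The alternating algorithm satisfies the conditions on algorithms\<close>

text \<open>Elements of \<^term>\<open>algorithms n\<close> are \<^const>\<open>undefined\<close> outside their domain, unlike \<^const>\<open>ALT\<close>.\<close>

definition restricted_ALT :: "nat \<Rightarrow> algorithm" where
  "restricted_ALT n = restrict (\<lambda>f. restrict (ALT n f) (cube (n+1))) (increasing_funs n)"

lemma truncation_cong:
  "(\<And>i. i \<in> {1..k} \<Longrightarrow> bin_digit x i = bin_digit y i) \<Longrightarrow> truncation k x = truncation k y"
  unfolding truncation_def by (intro sum.cong) auto

lemma feasible_set_cong:
  assumes "\<And>j i. j \<in> {1..n+1} \<Longrightarrow> i \<in> {1..count_list s j} \<Longrightarrow> bin_digit (x j) i = bin_digit (y j) i"
  shows "feasible_set n x s = feasible_set n y s"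
  unfolding feasible_set_def
proof (rule PiE_cong)
  fix j assume "j \<in> {1..n+1}"
  then have "truncation (count_list s j) (x j) = truncation (count_list s j) (y j)"
    using assms by (intro truncation_cong) auto
  then show "{truncation (count_list s j) (x j)..<truncation (count_list s j) (x j) + 1 / 2 ^ count_list s j} =
    {truncation (count_list s j) (y j)..<truncation (count_list s j) (y j) + 1 / 2 ^ count_list s j}"
    by simp
qed

lemma count_list_stake_mono: "l \<le> l' \<Longrightarrow> count_list (stake l w) j \<le> count_list (stake l' w) j"
  by (metis count_list_append le_Suc_ex le_add1 stake_add)

text \<open>Abstracts the stopping rule from crossing, so that runs on two inputs can be compared
  through their stopping predicates alone.\<close>

definition stop_string :: "(nat \<Rightarrow> bool) \<Rightarrow> 'a stream \<Rightarrow> 'a inf_string" where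
  "stop_string P w = (if \<exists>l. P l then FinStr (stake (LEAST l. P l) w) else InfStr w)"

lemma ALT_eq_stop_string:
  "ALT n f x = stop_string (\<lambda>l. \<not> crosses n f (feasible_set n x (stake l (cycle [1..<n+2])))) (cycle [1..<n+2])"
  unfolding ALT_def stop_string_def Let_def ..

lemma str_take_stop_string:
  "str_take l (stop_string P w) = stake (if \<exists>m\<le>l. P m then LEAST m. P m else l) w"
proof (cases "\<exists>m. P m")
  case True
  have "(LEAST m. P m) \<le> l \<longleftrightarrow> (\<exists>m\<le>l. P m)"
    using True by (meson LeastI_ex Least_le order_trans)
  then show ?thesis
    using True by (auto simp: stop_string_def take_stake min_def)
next
  case False
  then show ?thesis by (simp add: stop_string_def)
qed

text \<open>If \<open>P\<close> holds at some index up to the length of the given prefix,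
  \<open>P\<close> and \<open>Q\<close> have the same least index and the strings coincide.
  Otherwise neither stops by then, and both strings follow \<open>w\<close> for one more
  symbol.\<close>

lemma str_take_stop_string_cong:
  assumes PQ: "\<And>m. m \<le> length (str_take k (stop_string P w)) \<Longrightarrow> P m \<longleftrightarrow> Q m"
    and l: "l \<le> length (str_take k (stop_string P w)) + 1"
  shows "str_take l (stop_string P w) = str_take l (stop_string Q w)"
proof (cases "\<exists>m\<le>length (str_take k (stop_string P w)). P m")
  case True
  define L where "L = (LEAST m. P m)"
  have "P L" unfolding L_def using True by (blast intro: LeastI)
  have L_le: "L \<le> length (str_take k (stop_string P w))"
    using True Least_le unfolding L_def by (metis order_trans)
  have "(LEAST m. Q m) = L"
  proof (rule Least_equality)
    show "Q L" using PQ[OF L_le] \<open>P L\<close> by simp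
    show "L \<le> m" if "Q m" for m
      using that PQ[of m] Least_le[of P m] L_le unfolding L_def[symmetric]
      by (meson nle_le order_trans)
  qed
  moreover have "Q L" using PQ[OF L_le] \<open>P L\<close> by simp
  ultimately have "stop_string P w = stop_string Q w"
    using \<open>P L\<close> unfolding stop_string_def L_def[symmetric] by auto
  then show ?thesis by simp
next
  case False
  let ?len = "length (str_take k (stop_string P w))"
  have noQ: "\<not> Q m" and noP: "\<not> P m" if "m \<le> ?len" for m
    using False PQ that by auto
  have take: "str_take l (stop_string R w) = stake l w"
    if "\<And>m. m \<le> ?len \<Longrightarrow> \<not> R m" for R
  proof (cases "\<exists>m\<le>l. R m")
    case True
    then have "R (LEAST m. R m)" "(LEAST m. R m) \<le> l"
      by (meson LeastI, meson Least_le order_trans)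
    \<comment> \<open>A stop at or before \<open>l\<close> must come after \<open>?len\<close>,
      while \<open>l\<close> is at most \<open>?len + 1\<close>. So it occurs exactly at
      \<open>l\<close> and cuts nothing off the prefix of length \<open>l\<close>.\<close>
    then have "(LEAST m. R m) = l"
      using that l by (metis Suc_eq_plus1 le_SucE le_trans)
    then show ?thesis
      using True by (simp add: str_take_stop_string)
  next
    case False
    then show ?thesis
      by (simp only: str_take_stop_string if_False)
  qed
  show ?thesis using take[of P] take[of Q] noP noQ by simp
qed

lemma str_take_stop_string_eq_stake: "str_take l (stop_string P w) = stake (length (str_take l (stop_string P w))) w"
  by (simp add: str_take_stop_string)

text \<open>Each stopping test up to the length of \<open>s\<close> reads only bits revealed by a
  prefix of \<open>s\<close>. The two inputs agree on these, so their stopping predicates agree that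
  far.\<close>

lemma unrevealed_no_influence_ALT: "unrevealed_no_influence n (restricted_ALT n)"
  unfolding unrevealed_no_influence_def
proof (intro ballI allI impI, elim conjE)
  fix f p x y s l
  assume f: "f \<in> increasing_funs n" and x: "x \<in> cube (n+1)" and y: "y \<in> cube (n+1)"
    and bits: "\<forall>j\<in>{1..n+1}. \<forall>i\<in>{1..p j}. bin_digit (x j) i = bin_digit (y j) i"
    and s: "fin_prefix s (restricted_ALT n f x)"
    and count: "\<forall>j\<in>{1..n+1}. count_list s j \<le> p j"
    and l: "l \<le> length s + 1"
  let ?w = "cycle [1..<n+2]"
  let ?P = "\<lambda>x m. \<not> crosses n f (feasible_set n x (stake m ?w))"
  have eq: "restricted_ALT n f z = stop_string (?P z) ?w" if "z \<in> cube (n+1)" for z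
    unfolding ALT_eq_stop_string[symmetric] using f that by (simp add: restricted_ALT_def)
  obtain k where k: "s = str_take k (stop_string (?P x) ?w)"
    using s unfolding fin_prefix_def eq[OF x] by blast
  then have s_eq: "s = stake (length s) ?w"
    using str_take_stop_string_eq_stake by metis
  have "?P x m \<longleftrightarrow> ?P y m" if m: "m \<le> length s" for m
  proof -
    have "feasible_set n x (stake m ?w) = feasible_set n y (stake m ?w)"
    proof (rule feasible_set_cong)
      fix j i assume j: "j \<in> {1..n+1}" and i: "i \<in> {1..count_list (stake m ?w) j}"
      have "count_list (stake m ?w) j \<le> count_list s j"
        using count_list_stake_mono[OF m] s_eq by metis
      with count j i have "i \<in> {1..p j}" by fastforce
      with bits j show "bin_digit (x j) i = bin_digit (y j) i" by blast
    qed
    then show ?thesis by simp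
  qed
  then show "str_take l (restricted_ALT n f x) = str_take l (restricted_ALT n f y)"
    unfolding eq[OF x] eq[OF y] using l unfolding k by (rule str_take_stop_string_cong)
qed

lemma stop_string_eq_FinStrE:
  assumes "stop_string P w = FinStr s"
  obtains l where "s = stake l w" "P l"
  using assms unfolding stop_string_def by (metis LeastI inf_string.distinct(1) inf_string.inject(1))

lemma halting_ALT: "halting n (restricted_ALT n)"
  unfolding halting_def
proof (intro ballI allI impI)
  fix f x s
  assume "f \<in> increasing_funs n" "x \<in> cube (n+1)" "restricted_ALT n f x = FinStr s"
  then have "ALT n f x = FinStr s" by (simp add: restricted_ALT_def)
  then show "\<not> crosses n f (feasible_set n x s)"
    unfolding ALT_eq_stop_string by (rule stop_string_eq_FinStrE) blast
qed

lemma set_stop_string: "set_inf_string (stop_string P w) \<subseteq> sset w"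
proof -
  have "set (stake l w) \<subseteq> sset w" for l
    by (metis Un_upper1 sset_shift stake_sdrop)
  then show ?thesis
    by (simp add: stop_string_def)
qed

lemma ALT_in_cut_strings: "ALT n f x \<in> cut_strings n"
proof -
  have "sset (cycle [1..<n+2]) = {1..n+1}"
    by (subst sset_cycle) auto
  then show ?thesis
    unfolding ALT_eq_stop_string cut_strings_def using set_stop_string by (metis mem_Collect_eq)
qed

lemma restricted_ALT_in_algorithms: "restricted_ALT n \<in> algorithms n"
  unfolding algorithms_def
  using unrevealed_no_influence_ALT halting_ALT ALT_in_cut_strings
  by (auto simp: restricted_ALT_def)

lemma expected_length_restricted_ALT:
  assumes "f \<in> increasing_funs n"
  shows "expected_length n (restricted_ALT n) f = expected_length n (ALT n) f"
  unfolding expected_length_def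
  by (rule nn_integral_cong_AE, rule AE_mp[OF AE_input_law_cube])
    (use assms in \<open>simp add: restricted_ALT_def\<close>)

section \<open>The quadratic bound\<close>

text \<open>Dividing each factor by its power of two leaves \<open>1 - q / 2\<close> or
  \<open>1 - q\<close>, where \<open>q\<close> is \<open>(1/2) ^ k\<close>. Replacing the former by
  the smaller \<open>1 - q\<close> leaves a single power for Bernoulli's inequality.\<close>

lemma alternating_term_le:
  assumes i: "i \<le> n"
  shows "1 - ((2 ^ (k+1) - 1) ^ i * (2 ^ k - 1) ^ (n + 1 - i)) / 2 ^ (k * (n + 1) + i)
    \<le> (real n + 1) * (1 / 2) ^ k"
proof -
  define q :: real where "q = (1/2) ^ k"
  have q: "0 \<le> q" "q \<le> 1" by (auto simp: q_def power_le_one)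
  have "((2 ^ (k+1) - 1) ^ i * (2 ^ k - 1) ^ (n + 1 - i)) / (2::real) ^ (k * (n + 1) + i)
      = ((2 ^ (k+1) - 1) / 2 ^ (k+1)) ^ i * ((2 ^ k - 1) / 2 ^ k) ^ (n + 1 - i)"
    by (simp only: power_divide times_divide_times_eq power_alternating[OF i])
  also have "\<dots> = (1 - q / 2) ^ i * (1 - q) ^ (n + 1 - i)"
    by (simp add: q_def diff_divide_distrib power_one_over mult.commute)
  also have "\<dots> \<ge> (1 - q) ^ i * (1 - q) ^ (n + 1 - i)"
    using q by (intro mult_right_mono power_mono) auto
  also have "(1 - q) ^ i * (1 - q) ^ (n + 1 - i) = (1 - q) ^ (n + 1)"
    using i by (simp flip: power_add)
  also have "(1 - q) ^ (n + 1) \<ge> 1 - (real n + 1) * q"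
    using Bernoulli_inequality[of "- q" "n + 1"] q by (simp add: add.commute)
  finally show ?thesis by (simp add: q_def)
qed

lemma alternating_series_le:
  assumes n: "n \<ge> 1"
  shows "(\<Sum>k. \<Sum>i=0..n. ennreal (1 - ((2 ^ (k+1) - 1) ^ i * (2 ^ k - 1) ^ (n + 1 - i))
                                      / 2 ^ (k * (n + 1) + i))) \<le> ennreal (8 * real n ^ 2)"
proof -
  have "(\<Sum>k. \<Sum>i=0..n. ennreal (1 - ((2 ^ (k+1) - 1) ^ i * (2 ^ k - 1) ^ (n + 1 - i))
                                      / 2 ^ (k * (n + 1) + i)))
    \<le> (\<Sum>k. \<Sum>i=0..n. ennreal ((real n + 1) * (1 / 2) ^ k))"
    by (intro suminf_le sum_mono ennreal_leI alternating_term_le) auto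
  \<comment> \<open>The inner sum has \<open>n + 1\<close> equal terms, hence the square; the
    geometric series then contributes the factor 2.\<close>
  also have "\<dots> = (\<Sum>k. ennreal ((real n + 1) ^ 2 * (1 / 2) ^ k))"
    by (intro suminf_cong, subst sum_ennreal) (auto simp: power2_eq_square algebra_simps)
  also have "\<dots> = ennreal ((real n + 1) ^ 2 * 2)"
    using sums_mult[OF geometric_sums[of "1/2 :: real"], of "(real n + 1) ^ 2"]
    by (intro suminf_ennreal_eq) auto
  \<comment> \<open>Uses \<open>n + 1 <= 2 * n\<close>, valid for \<open>n >= 1\<close>.\<close>
  also have "\<dots> \<le> ennreal ((2 * real n) ^ 2 * 2)"
    using n by (intro ennreal_leI mult_right_mono power_mono) auto
  finally show ?thesis by (simp add: power_mult_distrib)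
qed

theorem calB_le:
  assumes "n \<ge> 1"
  shows "calB n \<le> ennreal (8 * real n ^ 2)"
proof -
  have "calB n \<le> (\<Squnion>f\<in>increasing_funs n. expected_length n (restricted_ALT n) f)"
    unfolding calB_def by (rule INF_lower[OF restricted_ALT_in_algorithms])
  also have "\<dots> \<le> ennreal (8 * real n ^ 2)"
    using expected_length_ALT_le alternating_series_le[OF assms] order_trans
    by (intro SUP_least) (fastforce simp only: expected_length_restricted_ALT)
  finally show ?thesis .
qed

theorem theorem1:
  shows "(\<forall>n\<ge>1. \<forall>f\<in>increasing_funs n.
      expected_length n (ALT n) f
        \<le> (\<Sum>k. \<Sum>i=0..n. ennreal (1 - ((2 ^ (k+1) - 1) ^ i * (2 ^ k - 1) ^ (n + 1 - i))
                                          / 2 ^ (k * (n + 1) + i)))) \<and>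
   (\<exists>C::real. C > 0 \<and> (\<forall>n\<ge>1. calB n \<le> ennreal (C * real n ^ 2)))"
proof (intro conjI allI ballI impI exI[of _ 8])
  fix n f assume "f \<in> increasing_funs n"
  then show "expected_length n (ALT n) f
    \<le> (\<Sum>k. \<Sum>i=0..n. ennreal (1 - ((2 ^ (k+1) - 1) ^ i * (2 ^ k - 1) ^ (n + 1 - i))
                                      / 2 ^ (k * (n + 1) + i)))"
    by (rule expected_length_ALT_le)
next
  fix n :: nat assume "1 \<le> n"
  then show "calB n \<le> ennreal (8 * real n ^ 2)"
    by (rule calB_le)
qed simp

end
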